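(* For every $s\in\mathbb{C}$ with $\Re(s)>1$, $$\sum_{n=1}^{\infty}\frac{1}{n^{s}}\cdot\sum_{p\in\mathbb{P}}\frac{1}{p^{s}}\,\frac{1}{\omega(np)}=\zeta(s)-1,$$ where the inner sum over $p$ depends on $n$ and lies inside the sum over $n$.
   Context: $\mathbb{P}$ is the set of prime numbers, $\omega(n)$ is the number of distinct primes dividing $n$, and $\zeta(s)=\sum_{n\ge1}n^{-s}$ for $\Re(s)>1$. *)

theory Defs
  imports "HOL-Analysis.Analysis" "HOL-Computational_Algebra.Primes"
begin

definition omega :: "nat \<Rightarrow> nat" where
  "omega n = card (prime_factors n)"

text \<open>Only meaningful where the series converges, i.e. for real part of \<open>s\<close> greater than 1;
  no analytic continuation is involved. The index is shifted so that it starts at 1.\<close>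

definition zeta :: "complex \<Rightarrow> complex" where
  "zeta s = (\<Sum>k. 1 / of_nat (Suc k) powr s)"

end

theory Submission
  imports Defs
begin

text \<open>
  Multiply the outer factor into the inner sum. Since \<open>f n = 1 / of_nat n powr s\<close> is completely
  multiplicative, the term at \<open>(n, p)\<close> depends only on the product \<open>m = n * p\<close>: it is \<open>f m\<close> divided
  by \<open>omega m\<close>. A given \<open>m \<ge> 1\<close> arises from exactly one pair for each prime divisor \<open>p\<close> of \<open>m\<close>,
  hence \<open>omega m\<close> times. The contributions to a given \<open>m \<ge> 2\<close> therefore add up to \<open>f m\<close>, while
  \<open>m = 1\<close> never arises; this accounts for the term 1 subtracted from \<open>zeta s\<close>.

  The regrouping is legitimate because the double family is dominated by the product of two
  absolutely summable families. This argument uses only that \<open>f\<close> is completely multiplicative and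
  absolutely summable, so \<open>has_sum_prime_divisor_average\<close> carries it out for an arbitrary such \<open>f\<close>.
\<close>

lemma omega_pos:
  assumes "m \<ge> 2"
  shows "omega m > 0"
proof -
  from assms obtain p where "prime p" "p dvd m"
    using prime_factor_nat[of m] by auto
  with assms have "p \<in> prime_factors m"
    by (simp add: prime_factors_dvd)
  then show ?thesis
    unfolding omega_def by (auto simp: card_gt_0_iff)
qed

lemma norm_divide_of_nat_le:
  fixes x :: "'a :: real_normed_field"
  shows "norm (x / of_nat k) \<le> norm x"
proof (cases "k = 0")
  case False
  then have "norm x * 1 \<le> norm x * real k"
    by (intro mult_left_mono) auto
  with False show ?thesis
    by (simp add: norm_divide divide_le_eq)
qed simp

text \<open>
  Dropping the weight \<open>1 / omega (n * p)\<close>, which is at most 1, leaves a product of a function of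
  \<open>n\<close> and a function of \<open>p\<close>.
\<close>

lemma abs_summable_on_omega_weighted_product:
  fixes f :: "nat \<Rightarrow> 'a :: {real_normed_field, banach}"
  assumes "(\<lambda>x. norm (f x)) summable_on A" and "(\<lambda>x. norm (f x)) summable_on B"
  shows "(\<lambda>x. norm (case x of (n, p) \<Rightarrow> f n * (f p * (1 / of_nat (omega (n * p))))))
           summable_on (A \<times> B)"
proof (rule Infinite_Sum.abs_summable_on_comparison_test)
  show "(\<lambda>x. norm (case x of (n, p) \<Rightarrow> f n * f p)) summable_on (A \<times> B)"
    using assms
    by (subst Infinite_Sum.abs_summable_on_Sigma_iff)
       (auto simp: norm_mult infsum_cmult_right' abs_mult infsum_nonneg
             intro!: summable_on_cmult_right summable_on_cmult_left)
next
  fix x assume "x \<in> A \<times> B"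
  obtain n p where x: "x = (n, p)" by fastforce
  show "norm (case x of (n, p) \<Rightarrow> f n * (f p * (1 / of_nat (omega (n * p)))))
          \<le> norm (case x of (n, p) \<Rightarrow> f n * f p)"
    using norm_divide_of_nat_le[of "f n * f p" "omega (n * p)"] by (simp add: x)
qed

lemma bij_betw_prime_multiple_pairs:
  "bij_betw (\<lambda>(n, p). (n * p, p)) ({1..} \<times> {p. prime p}) (Sigma {2::nat..} prime_factors)"
proof (rule bij_betw_byWitness[where f' = "\<lambda>(m, p). (m div p, p)"])
  have "2 \<le> n * p" if "n \<ge> 1" "prime p" for n p :: nat
    using mult_le_mono[OF that(1) prime_ge_2_nat[OF that(2)]] by simp
  then show "(\<lambda>(n, p). (n * p, p)) ` ({1..} \<times> {p. prime p}) \<subseteq> Sigma {2::nat..} prime_factors"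
    by (fastforce simp: prime_factors_dvd)
  show "(\<lambda>(m, p). (m div p, p)) ` Sigma {2::nat..} prime_factors \<subseteq> {1..} \<times> {p. prime p}"
    by (auto simp: prime_factors_dvd Suc_le_eq elim!: dvdE intro!: gr0I)
qed (auto simp: prime_factors_dvd)

text \<open>
  Both sides are the sum of \<open>f (n * p) / omega (n * p)\<close> over all pairs of an \<open>n \<ge> 1\<close> and a prime
  \<open>p\<close>. For the right-hand side, group the pairs by \<open>m = n * p\<close>: each group adds up to \<open>f m\<close>, as \<open>omega m\<close> equal terms with weight \<open>1 / omega m\<close>.
\<close>

lemma has_sum_prime_divisor_average:
  fixes f :: "nat \<Rightarrow> 'a :: {real_normed_field, banach}"
  assumes mult: "\<And>m n. m \<ge> 1 \<Longrightarrow> n \<ge> 1 \<Longrightarrow> f (m * n) = f m * f n"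
    and summable: "(\<lambda>x. norm (f x)) summable_on {1..}"
  shows "((\<lambda>n. f n * (\<Sum>\<^sub>\<infinity>p\<in>{p. prime p}. f p * (1 / of_nat (omega (n * p))))) has_sum
           infsum f {2..}) {1..}"
    and "\<And>n. (\<lambda>p. f p * (1 / of_nat (omega (n * p)))) summable_on {p. prime p}"
proof -
  define P :: "nat set" where "P = {p. prime p}"
  define w where "w n p = f p * (1 / of_nat (omega (n * p)))" for n p
  define h :: "nat \<times> nat \<Rightarrow> 'a" where "h = (\<lambda>(m, p). f m / of_nat (omega m))"
  have sumP: "(\<lambda>x. norm (f x)) summable_on P"
    by (rule summable_on_subset_banach[OF summable]) (auto simp: P_def dest: prime_ge_1_nat)

  have inner: "w n summable_on P" for n
    by (rule abs_summable_summable,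
        rule Infinite_Sum.abs_summable_on_comparison_test[OF sumP])
       (use norm_divide_of_nat_le in \<open>simp add: w_def\<close>)
  then show "(\<lambda>p. f p * (1 / of_nat (omega (n * p)))) summable_on {p. prime p}" for n
    unfolding w_def P_def .

  have "(\<lambda>(n, p). f n * w n p) summable_on ({1..} \<times> P)"
    using abs_summable_summable[OF abs_summable_on_omega_weighted_product[OF summable sumP]]
    by (simp add: w_def)
  then obtain S where S: "((\<lambda>(n, p). f n * w n p) has_sum S) ({1..} \<times> P)"
    by (auto simp: summable_on_def)

  have by_n: "((\<lambda>n. f n * infsum (w n) P) has_sum S) {1..}"
    by (rule has_sum_SigmaD[OF S]) (simp, intro has_sum_cmult_right has_sum_infsum inner)

  have regroup: "h (case x of (n, p) \<Rightarrow> (n * p, p)) = (case x of (n, p) \<Rightarrow> f n * w n p)"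
    if "x \<in> {1..} \<times> P" for x
    using that mult[of "fst x" "snd x"]
    by (auto simp: h_def w_def P_def dest: prime_ge_1_nat)
  have "((\<lambda>x. h (case x of (n, p) \<Rightarrow> (n * p, p))) has_sum S) ({1..} \<times> P)"
    by (rule iffD2[OF has_sum_cong[OF regroup] S])
  then have "(h has_sum S) (Sigma {2..} prime_factors)"
    unfolding P_def has_sum_reindex_bij_betw[OF bij_betw_prime_multiple_pairs] .
  then have "(f has_sum S) {2..}"
  proof (rule has_sum_SigmaD)
    fix m :: nat assume "m \<in> {2..}"
    then have "(\<Sum>p\<in>prime_factors m. h (m, p)) = f m"
      using omega_pos[of m] by (simp add: h_def flip: omega_def)
    then show "((\<lambda>p. h (m, p)) has_sum f m) (prime_factors m)"
      using has_sum_finite[of "prime_factors m" "\<lambda>p. h (m, p)"] by simp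
  qed
  then have "infsum f {2..} = S"
    by (rule infsumI)
  with by_n show "((\<lambda>n. f n * (\<Sum>\<^sub>\<infinity>p\<in>{p. prime p}. f p * (1 / of_nat (omega (n * p))))) has_sum
           infsum f {2..}) {1..}"
    unfolding w_def P_def by (simp only:)
qed

lemma bij_betw_Suc_atLeast_1: "bij_betw Suc UNIV {1..}"
  by (rule bij_betwI[of _ _ _ "\<lambda>n. n - 1"]) auto

lemma abs_summable_on_inverse_powr:
  fixes s :: complex
  assumes "Re s > 1"
  shows "(\<lambda>n::nat. norm (1 / of_nat n powr s)) summable_on {1..}"
proof -
  have "summable (\<lambda>n. real n powr (- Re s))"
    using assms by (simp add: summable_real_powr_iff)
  moreover have "norm (1 / of_nat n powr s) = real n powr (- Re s)" for n
    by (simp add: norm_divide norm_powr_real_powr powr_minus_divide)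
  ultimately have "(\<lambda>n::nat. norm (1 / of_nat n powr s)) summable_on UNIV"
    by (subst summable_on_UNIV_nonneg_real_iff) simp_all
  then show ?thesis
    by (rule summable_on_subset_banach) auto
qed

theorem proposition4p4:
  fixes s :: complex
  assumes "Re s > 1"
  shows "(\<forall>n\<ge>1. (\<lambda>p. 1 / of_nat p powr s * (1 / of_nat (omega (n * p))))
                  summable_on {p::nat. prime p}) \<and>
         (\<lambda>k. 1 / of_nat (Suc k) powr s *
               (\<Sum>\<^sub>\<infinity>p\<in>{p::nat. prime p}. 1 / of_nat p powr s * (1 / of_nat (omega (Suc k * p)))))
           sums (zeta s - 1)"
proof -
  define f :: "nat \<Rightarrow> complex" where "f n = 1 / of_nat n powr s" for n
  have mult: "f (m * n) = f m * f n" for m n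
    by (simp add: f_def powr_times_real)
  have summable: "(\<lambda>x. norm (f x)) summable_on {1..}"
    using abs_summable_on_inverse_powr[OF assms] by (simp add: f_def)
  note average = has_sum_prime_divisor_average[of f, OF mult summable]

  have "(f has_sum infsum f {1..}) {1..}"
    by (rule has_sum_infsum, rule abs_summable_summable, rule summable)
  then have "((\<lambda>k. f (Suc k)) has_sum infsum f {1..}) UNIV"
    by (simp only: has_sum_reindex_bij_betw[OF bij_betw_Suc_atLeast_1])
  then have "zeta s = infsum f {1..}"
    unfolding zeta_def f_def by (auto dest!: has_sum_imp_sums simp: sums_iff)
  also have "{1..} = insert 1 {2::nat..}"
    by auto
  also have "infsum f (insert 1 {2..}) = f 1 + infsum f {2..}"
    by (intro infsum_insert summable_on_subset_banach[OF abs_summable_summable[OF summable]]) auto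
  finally have "infsum f {2..} = zeta s - 1"
    by (simp add: f_def)
  with average(1)
  have "((\<lambda>k. f (Suc k) * (\<Sum>\<^sub>\<infinity>p\<in>{p. prime p}. f p * (1 / of_nat (omega (Suc k * p)))))
          has_sum (zeta s - 1)) UNIV"
    by (simp only: has_sum_reindex_bij_betw[OF bij_betw_Suc_atLeast_1,
          of "\<lambda>n. f n * (\<Sum>\<^sub>\<infinity>p\<in>{p. prime p}. f p * (1 / of_nat (omega (n * p))))"])
  then show ?thesis
    using average(2) unfolding f_def by (auto intro!: has_sum_imp_sums)
qed

end
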